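(* Let $(X,\mathcal A,\mu)$ be a $\sigma$-finite complete measure space, $T:X\to X$ a non-singular measurable transformation with $\mu(T(E))\le\mu(E)$ for every $E\in\mathcal A$, and $u:X\to\mathbb C$ a measurable function, not a.e. zero, such that $W_{u,T}$ is a bounded operator on $L(p,q)$. If for every $k\in\mathbb N\cup\{0\}$ there is at least one $x\in\mathcal E_k$ such that the subset $A_x^k$ of $\mathcal E_k$ is a separable measurable set, then $\beta(W_{u,T})=\infty$.
   Context: For measurable $h:X\to\mathbb C$ put $\mu_h(s)=\mu(\{x\in X:|h(x)|>s\})$ for $s\ge 0$, $h^*(t)=\inf\{s>0:\mu_h(s)\le t\}$ and $h^{**}(t)=\frac1t\int_0^t h^*(s)\,ds$ for $t>0$. The Lorentz space $L(p,q)$ (for $1<p<\infty$, $1\le q<\infty$, or $1<p\le\infty$, $q=\infty$) is the Banach space of (a.e.-equivalence classes of) measurable $h:X\to\mathbb C$ with $\|h\|_{pq}<\infty$, where $\|h\|_{pq}=\left(\frac qp\int_0^\infty (t^{1/p}h^{**}(t))^q\frac{dt}{t}\right)^{1/q}$ if $1<p<\infty$, $1\le q<\infty$, and $\|h\|_{pq}=\sup_{t>0}t^{1/p}h^{**}(t)$ if $1<p\le\infty$, $q=\infty$. A measurable transformation $T:X\to X$ is non-singular if $\mu(A)=0$ implies $\mu(T^{-1}(A))=0$. The hypothesis $\mu(T(E))\le\mu(E)$ for $E\in\mathcal A$ includes that $T(E)\in\mathcal A$. $W_{u,T}f=(u\circ T)\cdot(f\circ T)$. $N_0=X$ and $N_k=\{x\in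 X: u(T^i(x))\neq 0\text{ for all }1\le i\le k\}$ for $k\ge 1$. For $k\ge 0$, $\mathcal E_k=\{x\in T^k(N_{k+1}):\exists\,y\in T^k(N_{k+1}),\ y\ne x,\ T(y)=T(x)\}$, and for $x\in\mathcal E_k$, $A_x^k=\{y\in\mathcal E_k: T(y)=T(x)\}$. A measurable set $E$ is called separable if $E=E_1\cup E_2$ with $E_1,E_2\subseteq E$ measurable, disjoint, $\mu(E_1)>0$ and $\mu(E_2)>0$. For a bounded operator $L$ with range $\mathcal R(L)$, the descent is $\beta(L)=\inf\{k\in\mathbb N\cup\{0\}:\mathcal R(L^{k+1})=\mathcal R(L^k)\}$ (equal to $\infty$ if no such $k$ exists). *)

theory Defs
  imports "HOL-Analysis.Analysis" "HOL-Library.Extended_Nat"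
begin

definition distribution_fun :: "'a measure \<Rightarrow> ('a \<Rightarrow> complex) \<Rightarrow> real \<Rightarrow> ennreal" where
  "distribution_fun M h s = emeasure M {x \<in> space M. norm (h x) > s}"

text \<open>The infimum of the empty set is \<open>\<infinity>\<close>, so the rearrangement is extended-real valued.\<close>

definition rearrangement :: "'a measure \<Rightarrow> ('a \<Rightarrow> complex) \<Rightarrow> real \<Rightarrow> ennreal" where
  "rearrangement M h t = Inf {ennreal s | s. s > 0 \<and> distribution_fun M h s \<le> ennreal t}"

definition maximal_rearrangement :: "'a measure \<Rightarrow> ('a \<Rightarrow> complex) \<Rightarrow> real \<Rightarrow> ennreal" where
  "maximal_rearrangement M h t =
     ennreal (1 / t) * (\<integral>\<^sup>+ s\<in>{0..t}. rearrangement M h s \<partial>lborel)"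

text \<open>Real powers of extended nonnegative reals; only meant for exponents \<open>a > 0\<close>.\<close>

definition ennreal_powr :: "ennreal \<Rightarrow> real \<Rightarrow> ennreal" where
  "ennreal_powr x a = (if x = \<infinity> then \<infinity> else ennreal (enn2real x powr a))"

definition lorentz_indices :: "ennreal \<Rightarrow> ennreal \<Rightarrow> bool" where
  "lorentz_indices p q \<longleftrightarrow>
     (1 < p \<and> p < \<infinity> \<and> 1 \<le> q \<and> q < \<infinity>) \<or> (1 < p \<and> p \<le> \<infinity> \<and> q = \<infinity>)"

text \<open>For \<open>p = \<infinity>\<close> the exponent \<open>1 / p\<close> is \<open>0\<close>, since \<open>1 / \<infinity> = 0\<close> in \<^typ>\<open>ennreal\<close>.\<close>

definition lorentz_norm ::
  "'a measure \<Rightarrow> ennreal \<Rightarrow> ennreal \<Rightarrow> ('a \<Rightarrow> complex) \<Rightarrow> ennreal" where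
  "lorentz_norm M p q h =
     (if q = \<infinity>
      then SUP t\<in>{0<..}. ennreal (t powr enn2real (1 / p)) * maximal_rearrangement M h t
      else ennreal_powr
        (q / p * (\<integral>\<^sup>+ t\<in>{0<..}.
           ennreal_powr (ennreal (t powr enn2real (1 / p)) * maximal_rearrangement M h t)
             (enn2real q) * ennreal (1 / t) \<partial>lborel))
        (1 / enn2real q))"

definition ae_rel :: "'a measure \<Rightarrow> (('a \<Rightarrow> complex) \<times> ('a \<Rightarrow> complex)) set" where
  "ae_rel M = {(f, g). f \<in> borel_measurable M \<and> g \<in> borel_measurable M \<and> (AE x in M. f x = g x)}"

abbreviation ae_class :: "'a measure \<Rightarrow> ('a \<Rightarrow> complex) \<Rightarrow> ('a \<Rightarrow> complex) set" where
  "ae_class M f \<equiv> ae_rel M `` {f}"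

definition lorentz_space ::
  "'a measure \<Rightarrow> ennreal \<Rightarrow> ennreal \<Rightarrow> ('a \<Rightarrow> complex) set set" where
  "lorentz_space M p q = {h \<in> borel_measurable M. lorentz_norm M p q h < \<infinity>} // ae_rel M"

definition lorentz_class_norm ::
  "'a measure \<Rightarrow> ennreal \<Rightarrow> ennreal \<Rightarrow> ('a \<Rightarrow> complex) set \<Rightarrow> ennreal" where
  "lorentz_class_norm M p q F = the_elem (lorentz_norm M p q ` F)"

lemma equiv_ae_rel: "equiv (borel_measurable M) (ae_rel M)"
  unfolding ae_rel_def
  by (intro equivI refl_onI symI transI) auto

lemma lorentz_norm_cong_AE:
  assumes "(f, g) \<in> ae_rel M"
  shows "lorentz_norm M p q f = lorentz_norm M p q g"
proof -
  have [measurable]: "f \<in> borel_measurable M" "g \<in> borel_measurable M"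
    and ae: "AE x in M. f x = g x"
    using assms by (auto simp: ae_rel_def)
  have "distribution_fun M f = distribution_fun M g"
    unfolding distribution_fun_def using ae by (intro ext emeasure_eq_AE) auto
  then show ?thesis
    by (simp add: lorentz_norm_def maximal_rearrangement_def rearrangement_def)
qed

lemma lorentz_class_norm_ae_class:
  assumes "f \<in> borel_measurable M"
  shows "lorentz_class_norm M p q (ae_class M f) = lorentz_norm M p q f"
proof -
  have "f \<in> ae_class M f"
    using assms by (simp add: ae_rel_def)
  moreover have "lorentz_norm M p q g = lorentz_norm M p q f" if "g \<in> ae_class M f" for g
    using that lorentz_norm_cong_AE[of f g M p q] by simp
  ultimately have "lorentz_norm M p q ` ae_class M f = {lorentz_norm M p q f}"
    by blast
  then show ?thesis
    by (simp add: lorentz_class_norm_def)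
qed

text \<open>Linearity of \<open>L\<close> on equivalence classes is stated through representatives.\<close>

definition bounded_lorentz_operator ::
  "'a measure \<Rightarrow> ennreal \<Rightarrow> ennreal \<Rightarrow> (('a \<Rightarrow> complex) set \<Rightarrow> ('a \<Rightarrow> complex) set) \<Rightarrow> bool" where
  "bounded_lorentz_operator M p q L \<longleftrightarrow>
     (\<forall>F\<in>lorentz_space M p q. L F \<in> lorentz_space M p q) \<and>
     (\<forall>F\<in>lorentz_space M p q. \<forall>G\<in>lorentz_space M p q. \<forall>f\<in>F. \<forall>g\<in>G. \<forall>f'\<in>L F. \<forall>g'\<in>L G.
        \<forall>a b. (\<lambda>x. a * f' x + b * g' x) \<in> L (ae_class M (\<lambda>x. a * f x + b * g x))) \<and>
     (\<exists>C::real. \<forall>F\<in>lorentz_space M p q.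
        lorentz_class_norm M p q (L F) \<le> ennreal C * lorentz_class_norm M p q F)"

text \<open>An infimum in \<^typ>\<open>enat\<close>; it is \<open>\<infinity>\<close> if no such \<open>k\<close> exists.\<close>

definition descent :: "'b set \<Rightarrow> ('b \<Rightarrow> 'b) \<Rightarrow> enat" where
  "descent V L = Inf {enat k | k. (L ^^ (k + 1)) ` V = (L ^^ k) ` V}"

definition nonsingular :: "'a measure \<Rightarrow> ('a \<Rightarrow> 'a) \<Rightarrow> bool" where
  "nonsingular M T \<longleftrightarrow>
     (\<forall>A\<in>sets M. emeasure M A = 0 \<longrightarrow> emeasure M (T -` A \<inter> space M) = 0)"

text \<open>The operator induced on a.e.\ classes by \<open>f \<mapsto> (u \<circ> T) \<cdot> (f \<circ> T)\<close>; the union over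
  representatives is again a single class when \<open>T\<close> is nonsingular.\<close>

definition weighted_comp ::
  "'a measure \<Rightarrow> ('a \<Rightarrow> complex) \<Rightarrow> ('a \<Rightarrow> 'a) \<Rightarrow> ('a \<Rightarrow> complex) set \<Rightarrow> ('a \<Rightarrow> complex) set" where
  "weighted_comp M u T F = (\<Union>f\<in>F. ae_class M (\<lambda>x. u (T x) * f (T x)))"

lemma weighted_comp_ae_class:
  assumes [measurable]: "T \<in> M \<rightarrow>\<^sub>M M" "u \<in> borel_measurable M" "f \<in> borel_measurable M"
    and "nonsingular M T"
  shows "weighted_comp M u T (ae_class M f) = ae_class M (\<lambda>x. u (T x) * f (T x))"
proof -
  have "congruent (ae_rel M) (\<lambda>f. ae_class M (\<lambda>x. u (T x) * f (T x)))"
  proof (rule congruentI)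
    fix f g assume fg: "(f, g) \<in> ae_rel M"
    then have [measurable]: "f \<in> borel_measurable M" "g \<in> borel_measurable M"
      and ae: "AE x in M. f x = g x"
      by (auto simp: ae_rel_def)
    let ?A = "{x \<in> space M. f x \<noteq> g x}"
    have "emeasure M ?A = 0"
      using ae by (subst (asm) AE_iff_measurable[OF _ refl]) auto
    then have "emeasure M (T -` ?A \<inter> space M) = 0"
      using assms(4) unfolding nonsingular_def by (auto dest: bspec[where x = ?A])
    moreover have "T -` ?A \<inter> space M = {x \<in> space M. f (T x) \<noteq> g (T x)}"
      using measurable_space[OF assms(1)] by auto
    ultimately have "AE x in M. f (T x) = g (T x)"
      by (subst AE_iff_measurable[OF _ refl]) auto
    then have "((\<lambda>x. u (T x) * f (T x)), (\<lambda>x. u (T x) * g (T x))) \<in> ae_rel M"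
      by (auto simp: ae_rel_def)
    then show "ae_class M (\<lambda>x. u (T x) * f (T x)) = ae_class M (\<lambda>x. u (T x) * g (T x))"
      by (rule equiv_class_eq[OF equiv_ae_rel])
  qed
  then show ?thesis
    unfolding weighted_comp_def by (intro UN_equiv_class[OF equiv_ae_rel]) auto
qed

definition nonvanishing_set ::
  "'a measure \<Rightarrow> ('a \<Rightarrow> complex) \<Rightarrow> ('a \<Rightarrow> 'a) \<Rightarrow> nat \<Rightarrow> 'a set" where
  "nonvanishing_set M u T k = {x \<in> space M. \<forall>i\<in>{1..k}. u ((T ^^ i) x) \<noteq> 0}"

definition collision_set ::
  "'a measure \<Rightarrow> ('a \<Rightarrow> complex) \<Rightarrow> ('a \<Rightarrow> 'a) \<Rightarrow> nat \<Rightarrow> 'a set" where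
  "collision_set M u T k =
     {x \<in> (T ^^ k) ` nonvanishing_set M u T (k + 1).
        \<exists>y \<in> (T ^^ k) ` nonvanishing_set M u T (k + 1). y \<noteq> x \<and> T y = T x}"

definition collision_fibre ::
  "'a measure \<Rightarrow> ('a \<Rightarrow> complex) \<Rightarrow> ('a \<Rightarrow> 'a) \<Rightarrow> nat \<Rightarrow> 'a \<Rightarrow> 'a set" where
  "collision_fibre M u T k x = {y \<in> collision_set M u T k. T y = T x}"

definition separable_set :: "'a measure \<Rightarrow> 'a set \<Rightarrow> bool" where
  "separable_set M E \<longleftrightarrow> E \<in> sets M \<and>
     (\<exists>E1\<in>sets M. \<exists>E2\<in>sets M. E = E1 \<union> E2 \<and> E1 \<inter> E2 = {} \<and>
        emeasure M E1 > 0 \<and> emeasure M E2 > 0)"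

end

theory Submission
  imports Defs
begin

text \<open>
  The iterate \<open>W\<^sup>k\<close> acts by \<open>f \<mapsto> w\<^sub>k \<cdot> (f \<circ> T\<^sup>k)\<close> with \<open>w\<^sub>k = (u \<circ> T) \<cdots> (u \<circ> T\<^sup>k)\<close>.
  Split the fibre \<open>A\<close> over \<open>z = T x\<close> into two parts \<open>E\<^sub>1\<close>, \<open>E\<^sub>2\<close> of positive measure and let \<open>f\<close> be
  the indicator of a subset of \<open>E\<^sub>1\<close> of finite positive measure. On \<open>T\<^sup>-\<^sup>k(A)\<close> every function in the
  range of \<open>W\<^sup>k\<^sup>+\<^sup>1\<close> has the form \<open>w\<^sub>k \<cdot> c\<close> with the constant \<open>c = u(z) g(z)\<close>, whereas
  \<open>W\<^sup>k f\<close> equals \<open>w\<^sub>k\<close> over the support of \<open>f\<close> and \<open>0\<close> over \<open>E\<^sub>2\<close>. Both parts have preimages of positive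
  measure in \<open>N\<^sub>k\<^sub>+\<^sub>1\<close>, because \<open>T\<close> does not increase measure, and \<open>w\<^sub>k\<close> does not vanish there.
\<close>

subsection \<open>Indicators of sets of finite measure\<close>

lemma distribution_fun_indicator_le:
  assumes "s > 0" "E \<in> sets M"
  shows "distribution_fun M (indicator E) s \<le> emeasure M E"
  unfolding distribution_fun_def using assms
  by (intro emeasure_mono) (auto simp: indicator_def split: if_splits)

text \<open>The level 1 is always admissible in the infimum, since \<open>distribution_fun\<close>
  uses a strict inequality and an indicator never exceeds 1.\<close>

lemma rearrangement_indicator_le_1: "rearrangement M (indicator E) t \<le> 1"
proof -
  have "distribution_fun M (indicator E) 1 = 0"
    by (auto simp: distribution_fun_def indicator_def)
  then show ?thesis
    unfolding rearrangement_def by (intro Inf_lower CollectI exI[of _ 1]) auto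
qed

text \<open>Every level set at height \<open>e > 0\<close> lies in \<open>E\<close>, so arbitrarily
  small \<open>e\<close> are admissible in the infimum.\<close>

lemma rearrangement_indicator_eq_0:
  assumes "E \<in> sets M" "emeasure M E \<le> ennreal t"
  shows "rearrangement M (indicator E) t = 0"
proof -
  have "rearrangement M (indicator E) t \<le> 0 + ennreal e" if "e > 0" for e
  proof -
    have "distribution_fun M (indicator E) e \<le> ennreal t"
      using distribution_fun_indicator_le[OF that assms(1)] assms(2) by (rule order_trans)
    then show ?thesis
      unfolding rearrangement_def using that by (auto intro!: Inf_lower)
  qed
  then show ?thesis
    using ennreal_le_epsilon[of 0] by (metis le_zero_eq)
qed

text \<open>The rearrangement is dominated by the indicator of the interval from 0 to
  \<open>m\<close>, whose mean over \<open>{0..t}\<close> is \<open>min t m / t\<close>.\<close>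

lemma maximal_rearrangement_indicator_le:
  assumes "E \<in> sets M" "emeasure M E \<le> ennreal m" "m \<ge> 0" "t > 0"
  shows "maximal_rearrangement M (indicator E) t \<le> ennreal (min 1 (m / t))"
proof -
  have "(\<integral>\<^sup>+ s\<in>{0..t}. rearrangement M (indicator E) s \<partial>lborel)
      \<le> (\<integral>\<^sup>+ s. indicator {0..min t m} s \<partial>lborel)"
  proof (rule nn_integral_mono)
    fix s :: real
    have "rearrangement M (indicator E) s = 0" if "m \<le> s"
      using assms that by (intro rearrangement_indicator_eq_0) (auto intro: order_trans ennreal_leI)
    then show "rearrangement M (indicator E) s * indicator {0..t} s \<le> indicator {0..min t m} s"
      using rearrangement_indicator_le_1[of M E s] by (auto simp: indicator_def)
  qed
  also have "\<dots> = ennreal (min t m)"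
    using assms by simp
  finally have "maximal_rearrangement M (indicator E) t \<le> ennreal (1 / t) * ennreal (min t m)"
    unfolding maximal_rearrangement_def by (intro mult_left_mono) auto
  also have "\<dots> = ennreal (1 / t * min t m)"
    using assms by (intro ennreal_mult[symmetric]) auto
  also have "1 / t * min t m = min 1 (m / t)"
    using assms by (auto simp: min_def field_simps)
  finally show ?thesis .
qed

lemma ennreal_powr_mono:
  assumes "x \<le> y" "a \<ge> 0"
  shows "ennreal_powr x a \<le> ennreal_powr y a"
  using assms unfolding ennreal_powr_def
  by (auto intro!: ennreal_leI powr_mono2 enn2real_mono simp: top.not_eq_extremum top_unique)

lemma ennreal_powr_less_top: "x < \<infinity> \<Longrightarrow> ennreal_powr x a < \<infinity>"
  by (auto simp: ennreal_powr_def)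

text \<open>Provides the test functions. With \<open>a\<close> standing for 1/p, the weighted
  average is bounded by t^a near 0 and by a multiple of t^(a - 1) at infinity; both are under
  control because p > 1 gives 0 \<le> a < 1.\<close>

lemma lorentz_norm_indicator_finite:
  assumes ind: "lorentz_indices p q" and E: "E \<in> sets M" and fin: "emeasure M E < \<infinity>"
  shows "lorentz_norm M p q (indicator E) < \<infinity>"
proof -
  \<comment> \<open>The added 1 keeps \<open>m\<close> positive even if \<open>E\<close> is a null
    set.\<close>
  define m where "m = measure M E + 1"
  have m: "m > 0" and Em: "emeasure M E \<le> ennreal m"
    using fin by (auto simp: m_def emeasure_eq_ennreal_measure add_nonneg_pos intro!: ennreal_leI)
  define a where "a = enn2real (1 / p)"
  have p: "p = \<infinity> \<or> (\<exists>r>1. p = ennreal r)"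
    using ind unfolding lorentz_indices_def by (cases p) auto
  then have a: "0 \<le> a" "a < 1"
    by (auto simp: a_def divide_ennreal simp flip: ennreal_1)
  define b where "b t = t powr a * min 1 (m / t)" for t
  have b: "ennreal (t powr a) * maximal_rearrangement M (indicator E) t \<le> ennreal (b t)" if "t > 0" for t
  proof -
    have "ennreal (t powr a) * maximal_rearrangement M (indicator E) t
        \<le> ennreal (t powr a) * ennreal (min 1 (m / t))"
      using m that by (intro mult_left_mono maximal_rearrangement_indicator_le E Em) auto
    also have "\<dots> = ennreal (b t)"
      unfolding b_def using m that by (intro ennreal_mult[symmetric]) auto
    finally show ?thesis .
  qed
  show ?thesis
  proof (cases "q = \<infinity>")
    case True
    have "b t \<le> m powr a" if "t > 0" for t
    proof -
      \<comment> \<open>For \<open>x \<ge> 1\<close> use 1 \<le> x^a; for \<open>x < 1\<close> use x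
        \<le> x^a, valid since \<open>a < 1\<close>.\<close>
      have "min 1 x \<le> x powr a" if "x > 0" for x :: real
        using that a ge_one_powr_ge_zero[of x a] powr_mono'[of a 1 x] by (cases "x \<ge> 1") auto
      then have "b t \<le> t powr a * (m / t) powr a"
        unfolding b_def using m that by (intro mult_left_mono) auto
      also have "\<dots> = m powr a"
        using m that by (simp add: powr_divide)
      finally show ?thesis .
    qed
    then have "lorentz_norm M p q (indicator E) \<le> ennreal (m powr a)"
      unfolding lorentz_norm_def a_def[symmetric] using True
      by (auto intro!: SUP_least order_trans[OF b] ennreal_leI)
    then show ?thesis
      by (rule order.strict_trans1) simp
  next
    case False
    then obtain r where r: "r > 1" "p = ennreal r"
      using p ind by (auto simp: lorentz_indices_def)
    obtain s where s: "s \<ge> 1" "q = ennreal s"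
      using ind False unfolding lorentz_indices_def by (cases q) auto
    have "a > 0"
      using r by (simp add: a_def divide_ennreal flip: ennreal_1)
    \<comment> \<open>Majorants of \<open>b t powr s / t\<close> below and above \<open>m\<close>,
      the second up to the factor \<open>m powr s\<close>. They are integrable because
      \<open>a * s > 0\<close> and \<open>(a - 1) * s < 0\<close>; the first of these rests on p
      being finite whenever q is.\<close>
    define F where "F t = ennreal (t powr (a * s - 1)) * indicator {0..m} t" for t
    define G where "G t = ennreal (t powr ((a - 1) * s - 1)) * indicator {m..} t" for t
    have as: "a * s > 0" "(a - 1) * s < 0"
      using \<open>a > 0\<close> a s by (auto simp: mult_neg_pos)
    have F: "(\<integral>\<^sup>+ t. F t \<partial>lborel) < \<infinity>"
      unfolding F_def using m as
      by (subst nn_integral_has_integral_lebesgue'[OF _ has_integral_powr_from_0]) auto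
    have G: "(\<integral>\<^sup>+ t. G t \<partial>lborel) < \<infinity>"
      unfolding G_def using m as
      by (subst nn_integral_has_integral_lebesgue'[OF _ has_integral_powr_to_inf]) auto
    have "(\<integral>\<^sup>+ t\<in>{0<..}. ennreal_powr (ennreal (t powr a) * maximal_rearrangement M (indicator E) t)
             s * ennreal (1 / t) \<partial>lborel)
        \<le> (\<integral>\<^sup>+ t. F t + ennreal (m powr s) * G t \<partial>lborel)"
    proof (rule nn_integral_mono)
      fix t :: real
      show "ennreal_powr (ennreal (t powr a) * maximal_rearrangement M (indicator E) t) s
          * ennreal (1 / t) * indicator {0<..} t \<le> F t + ennreal (m powr s) * G t"
      proof (cases "t > 0")
        case t: True
        have "b t \<ge> 0"
          using m t by (simp add: b_def)
        have "ennreal_powr (ennreal (t powr a) * maximal_rearrangement M (indicator E) t) s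
            * ennreal (1 / t) \<le> ennreal_powr (ennreal (b t)) s * ennreal (1 / t)"
          using b[OF t] s by (intro mult_right_mono ennreal_powr_mono) auto
        also have "\<dots> = ennreal (b t powr s / t)"
          using \<open>b t \<ge> 0\<close> t by (simp add: ennreal_powr_def flip: ennreal_mult)
        also have "\<dots> \<le> F t + ennreal (m powr s) * G t"
        proof (cases "t \<le> m")
          case True
          then have "b t powr s / t = t powr (a * s - 1)"
            using t by (simp add: b_def powr_powr powr_diff)
          then have "ennreal (b t powr s / t) = F t"
            using True t by (simp add: F_def)
          then show ?thesis
            by simp
        next
          case False
          then have "b t = m * t powr (a - 1)"
            using t m by (simp add: b_def powr_diff min_def field_simps)
          then have "b t powr s / t = m powr s * (t powr ((a - 1) * s) / t powr 1)"
            using t m by (simp only: powr_mult powr_powr powr_one) simp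
          also have "\<dots> = m powr s * t powr ((a - 1) * s - 1)"
            by (simp only: powr_diff)
          finally have "ennreal (b t powr s / t) = ennreal (m powr s) * G t"
            using False t by (simp add: G_def ennreal_mult)
          then show ?thesis
            by simp
        qed
        finally show ?thesis
          using t by simp
      qed simp
    qed
    also have "\<dots> = (\<integral>\<^sup>+ t. F t \<partial>lborel) + ennreal (m powr s) * (\<integral>\<^sup>+ t. G t \<partial>lborel)"
      unfolding F_def G_def by (simp add: nn_integral_add nn_integral_cmult)
    also have "\<dots> < \<infinity>"
      using F G by (simp add: ennreal_mult_less_top)
    finally show ?thesis
      unfolding lorentz_norm_def a_def[symmetric] using s r False
      by (auto intro!: ennreal_powr_less_top[unfolded infinity_ennreal_def]
          simp: ennreal_mult_less_top divide_ennreal)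
  qed
qed

lemma indicator_in_lorentz_space:
  assumes "lorentz_indices p q" "E \<in> sets M" "emeasure M E < \<infinity>"
  shows "ae_class M (indicator E) \<in> lorentz_space M p q"
  unfolding lorentz_space_def using assms lorentz_norm_indicator_finite[OF assms]
  by (intro quotientI) auto

lemma lorentz_space_repr:
  assumes "F \<in> lorentz_space M p q"
  obtains f where "f \<in> borel_measurable M" "F = ae_class M f"
  using assms unfolding lorentz_space_def by (auto elim: quotientE)

subsection \<open>Sets of positive measure\<close>

text \<open>One piece of a countable cover by sets of finite measure must meet \<open>E\<close> in
  positive measure, as otherwise \<open>E\<close> would be a countable union of null sets.\<close>

lemma (in sigma_finite_measure) finite_positive_subset:
  assumes "E \<in> sets M" "emeasure M E > 0"
  obtains E' where "E' \<in> sets M" "E' \<subseteq> E" "emeasure M E' > 0" "emeasure M E' < \<infinity>"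
proof -
  obtain A :: "nat \<Rightarrow> 'a set" where A: "range A \<subseteq> sets M" "(\<Union>i. A i) = space M"
    "\<And>i. emeasure M (A i) \<noteq> \<infinity>"
    using sigma_finite by blast
  have "\<exists>i. emeasure M (E \<inter> A i) > 0"
  proof (rule ccontr)
    assume "\<not> ?thesis"
    then have "emeasure M (\<Union>i. E \<inter> A i) = 0"
      using A assms by (intro emeasure_UN_eq_0) auto
    moreover have "(\<Union>i. E \<inter> A i) = E"
      using A(2) sets.sets_into_space[OF assms(1)] by auto
    ultimately show False
      using assms by simp
  qed
  then obtain i where i: "emeasure M (E \<inter> A i) > 0" ..
  have "emeasure M (E \<inter> A i) \<le> emeasure M (A i)"
    using A by (intro emeasure_mono) auto
  also have "\<dots> < \<infinity>"
    using A(3)[of i] by (simp add: top.not_eq_extremum)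
  finally show ?thesis
    using that[of "E \<inter> A i"] assms A i by auto
qed

lemma AE_obtain_in_positive_set:
  assumes "AE x in M. P x" "B \<in> sets M" "emeasure M B > 0"
  obtains x where "x \<in> B" "P x"
proof (rule ccontr)
  assume "\<not> thesis"
  then have "AE x in M. x \<notin> B"
    using assms(1) that by (auto elim: eventually_mono)
  then have "B \<in> null_sets M"
    using assms(2) by (simp add: AE_iff_null_sets)
  then show False
    using assms(3) by auto
qed

subsection \<open>Iterates\<close>

lemma funpow_image_emeasure_le:
  assumes "\<forall>E\<in>sets M. T ` E \<in> sets M \<and> emeasure M (T ` E) \<le> emeasure M E" "E \<in> sets M"
  shows "(T ^^ k) ` E \<in> sets M \<and> emeasure M ((T ^^ k) ` E) \<le> emeasure M E"
proof (induction k)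
  case (Suc k)
  have "(T ^^ Suc k) ` E = T ` ((T ^^ k) ` E)"
    by (simp add: image_comp)
  then show ?case
    using Suc assms by (auto intro: order_trans)
qed (use assms in auto)

lemma weighted_comp_funpow_ae_class:
  assumes T [measurable]: "T \<in> M \<rightarrow>\<^sub>M M" and u [measurable]: "u \<in> borel_measurable M"
    and f [measurable]: "f \<in> borel_measurable M" and ns: "nonsingular M T"
  shows "(weighted_comp M u T ^^ k) (ae_class M f) =
    ae_class M (\<lambda>x. (\<Prod>i=1..k. u ((T ^^ i) x)) * f ((T ^^ k) x))"
proof (induction k)
  case (Suc k)
  have [measurable]: "(T ^^ i) \<in> M \<rightarrow>\<^sub>M M" for i
    by (rule measurable_compose_n[OF T])
  let ?w = "\<lambda>k x. \<Prod>i=1..k. u ((T ^^ i) x)"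
  \<comment> \<open>The inductive step applies the operator on the outside, which composes the
    previous weight with \<open>T\<close>; so the factor split off is the first one, not the
    last.\<close>
  have prod_shift: "?w (Suc k) x = u (T x) * ?w k (T x)" for x
    by (induction k) (simp_all add: funpow_swap1 mult.assoc)
  have "(weighted_comp M u T ^^ Suc k) (ae_class M f) =
      weighted_comp M u T (ae_class M (\<lambda>x. ?w k x * f ((T ^^ k) x)))"
    using Suc by simp
  also have "\<dots> = ae_class M (\<lambda>x. u (T x) * (?w k (T x) * f ((T ^^ k) (T x))))"
    by (intro weighted_comp_ae_class ns) measurable
  also have "(\<lambda>x. u (T x) * (?w k (T x) * f ((T ^^ k) (T x)))) =
      (\<lambda>x. ?w (Suc k) x * f ((T ^^ Suc k) x))"
    by (simp only: prod_shift mult.assoc funpow_Suc_right comp_apply)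
  finally show ?case .
qed simp

lemma nonvanishing_set_measurable:
  assumes T: "T \<in> M \<rightarrow>\<^sub>M M" and u [measurable]: "u \<in> borel_measurable M"
  shows "nonvanishing_set M u T k \<in> sets M"
proof -
  have [measurable]: "(T ^^ i) \<in> M \<rightarrow>\<^sub>M M" for i
    by (rule measurable_compose_n[OF T])
  show ?thesis
    unfolding nonvanishing_set_def by measurable
qed

text \<open>The a.e. identity to be exploited concerns points before \<open>T ^^ k\<close> is
  applied, so positivity must be carried back from \<open>E\<close> to \<open>B\<close>. Since
  \<open>T ^^ k\<close> maps \<open>B\<close> onto \<open>E\<close> and does not increase measure,
  \<open>B\<close> is at least as large as \<open>E\<close>.\<close>

lemma positive_preimage_in_nonvanishing_set:
  assumes T: "T \<in> M \<rightarrow>\<^sub>M M" and u: "u \<in> borel_measurable M"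
    and contr: "\<forall>E\<in>sets M. T ` E \<in> sets M \<and> emeasure M (T ` E) \<le> emeasure M E"
    and E: "E \<in> sets M" "E \<subseteq> (T ^^ k) ` nonvanishing_set M u T n" "emeasure M E > 0"
  defines "B \<equiv> {w \<in> nonvanishing_set M u T n. (T ^^ k) w \<in> E}"
  shows "B \<in> sets M" and "emeasure M B > 0"
proof -
  have "B = nonvanishing_set M u T n \<inter> ((T ^^ k) -` E \<inter> space M)"
    unfolding B_def nonvanishing_set_def by auto
  then show B: "B \<in> sets M"
    using nonvanishing_set_measurable[OF T u, of n]
      measurable_sets[OF measurable_compose_n[OF T] E(1), of k] by simp
  have "(T ^^ k) ` B = E"
    using E(2) by (auto simp: B_def)
  then show "emeasure M B > 0"
    using funpow_image_emeasure_le[OF contr B, of k] E(3) by auto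
qed

theorem theorem4p18:
  fixes M :: "'a measure" and T :: "'a \<Rightarrow> 'a" and u :: "'a \<Rightarrow> complex" and p q :: ennreal
  assumes "sigma_finite_measure M" and "complete_measure M"
    and "lorentz_indices p q"
    and "T \<in> M \<rightarrow>\<^sub>M M" and "nonsingular M T"
    and "\<forall>E\<in>sets M. T ` E \<in> sets M \<and> emeasure M (T ` E) \<le> emeasure M E"
    and "u \<in> borel_measurable M" and "\<not> (AE x in M. u x = 0)"
    and "bounded_lorentz_operator M p q (weighted_comp M u T)"
    and "\<forall>k. \<exists>x\<in>collision_set M u T k. separable_set M (collision_fibre M u T k x)"
  shows "descent (lorentz_space M p q) (weighted_comp M u T) = \<infinity>"
proof -
  let ?W = "weighted_comp M u T" and ?V = "lorentz_space M p q"
  let ?w = "\<lambda>k x. \<Prod>i=1..k. u ((T ^^ i) x)"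
  have Tk [measurable]: "(T ^^ i) \<in> M \<rightarrow>\<^sub>M M" for i
    by (rule measurable_compose_n[OF assms(4)])
  note [measurable] = assms(7)
  have "(?W ^^ (k + 1)) ` ?V \<noteq> (?W ^^ k) ` ?V" for k
  proof
    assume eq: "(?W ^^ (k + 1)) ` ?V = (?W ^^ k) ` ?V"
    let ?N = "nonvanishing_set M u T (k + 1)"
    obtain x where "separable_set M (collision_fibre M u T k x)"
      using assms(10) by auto
    then obtain E1 E2 where E: "collision_fibre M u T k x = E1 \<union> E2" "E1 \<inter> E2 = {}"
      "E1 \<in> sets M" "E2 \<in> sets M" "emeasure M E1 > 0" "emeasure M E2 > 0"
      unfolding separable_set_def by auto
    obtain E1' where E1': "E1' \<in> sets M" "E1' \<subseteq> E1" "emeasure M E1' > 0" "emeasure M E1' < \<infinity>"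
      using sigma_finite_measure.finite_positive_subset[OF assms(1) E(3,5)] by blast
    have fibre: "y \<in> (T ^^ k) ` ?N" "T y = T x" if "y \<in> E1 \<union> E2" for y
      using that unfolding E(1)[symmetric] by (auto simp: collision_fibre_def collision_set_def)
    let ?f = "indicator E1' :: 'a \<Rightarrow> complex"
    have f [measurable]: "?f \<in> borel_measurable M"
      using E1' by simp
    have "(?W ^^ k) (ae_class M ?f) \<in> (?W ^^ (k + 1)) ` ?V"
      unfolding eq using E1' by (intro imageI indicator_in_lorentz_space assms(3))
    then obtain G where G: "G \<in> ?V" "(?W ^^ k) (ae_class M ?f) = (?W ^^ (k + 1)) G"
      by blast
    obtain g where g [measurable]: "g \<in> borel_measurable M" and "G = ae_class M g"
      using G(1) by (rule lorentz_space_repr)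
    with G(2) have "ae_class M (\<lambda>x. ?w k x * ?f ((T ^^ k) x)) =
        ae_class M (\<lambda>x. ?w (k + 1) x * g ((T ^^ (k + 1)) x))"
      using weighted_comp_funpow_ae_class[OF assms(4,7) f assms(5), of k]
        weighted_comp_funpow_ae_class[OF assms(4,7) g assms(5), of "k + 1"] by simp
    then have "((\<lambda>x. ?w k x * ?f ((T ^^ k) x)), (\<lambda>x. ?w (k + 1) x * g ((T ^^ (k + 1)) x)))
        \<in> ae_rel M"
      by (rule eq_equiv_class[OF _ equiv_ae_rel]) measurable
    then have ae: "AE x in M. ?w k x * ?f ((T ^^ k) x) = ?w (k + 1) x * g ((T ^^ (k + 1)) x)"
      by (simp add: ae_rel_def)
    \<comment> \<open>Evaluate the identity at some \<open>w\<close> in the preimage of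
      \<open>E\<close> and cancel the nonzero weight \<open>?w k w\<close>. What remains on the
      right is \<open>u (T x) * g (T x)\<close>, the same number for every choice of
      \<open>E\<close>, because \<open>T\<close> is constant on the fibre.\<close>
    have val: "\<exists>y\<in>E. u (T x) * g (T x) = ?f y"
      if sub: "E \<subseteq> E1 \<union> E2" and pos: "E \<in> sets M" "emeasure M E > 0" for E
    proof -
      have "E \<subseteq> (T ^^ k) ` ?N"
        using sub fibre(1) by blast
      note B = positive_preimage_in_nonvanishing_set[OF assms(4,7,6) pos(1) this pos(2)]
      obtain w where w: "w \<in> ?N" "(T ^^ k) w \<in> E"
        "?w k w * ?f ((T ^^ k) w) = ?w (k + 1) w * g ((T ^^ (k + 1)) w)"
        using AE_obtain_in_positive_set[OF ae B] by blast
      have "T ((T ^^ k) w) = T x"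
        using w(2) sub fibre(2) by blast
      moreover have "?w k w \<noteq> 0"
        using w(1) by (auto simp: nonvanishing_set_def)
      ultimately have "u (T x) * g (T x) = ?f ((T ^^ k) w)"
        using w(3) by simp
      then show ?thesis
        using w(2) by blast
    qed
    \<comment> \<open>The choice \<open>E1'\<close> forces this common number to be 1, the choice
      \<open>E2\<close> forces it to be 0.\<close>
    have "u (T x) * g (T x) = 1"
      using val[of E1'] E1' by (auto simp: indicator_def)
    moreover obtain y where y: "y \<in> E2" "u (T x) * g (T x) = ?f y"
      using val[of E2] E(4,6) by auto
    moreover have "y \<notin> E1'"
      using y(1) E(2) E1'(2) by blast
    ultimately show False
      by simp
  qed
  then have "{enat k | k. (?W ^^ (k + 1)) ` ?V = (?W ^^ k) ` ?V} = {}"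
    by blast
  then show ?thesis
    unfolding descent_def by (simp only: Inf_enat_def if_True simp_thms)
qed

end
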